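(* Let $G,Q$ be locally compact groups and let $f:G\to Q$ be a resolution. Then $G$ is compactly generated if and only if $Q$ is compactly generated.
   Context: A morphism between topological groups is a continuous group homomorphism. Unitary representations are strongly continuous; a unitary representation $\pi$ of $G$ almost has invariant vectors if for every compact $K\subset G$ and $\varepsilon>0$ there is a nonzero vector $\xi$ with $\sup_{g\in K}\|\pi(g)\xi-\xi\|\le\varepsilon\|\xi\|$. A morphism $f:G\to Q$ with dense image between locally compact groups is a resolution if every unitary representation $\pi$ of $G$ almost having invariant vectors has a nonzero subrepresentation $\rho$ that factors as $\rho=\tilde\rho\circ f$ with $\tilde\rho$ a unitary representation of $Q$ that almost has invariant vectors (as a representation of $Q$). *)

theory Defs
  imports "HOL-Analysis.Analysis" "HOL-Algebra.Module" "HOL-Algebra.Generated_Groups"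
    "HOL-Algebra.Group_Action"
begin

section \<open>Topological groups\<close>

locale topological_group = group G for G :: "('g, 'm) monoid_scheme" (structure) +
  fixes T :: "'g topology"
  assumes topspace_eq: "topspace T = carrier G"
    and continuous_mult: "continuous_map (prod_topology T T) T (\<lambda>(x, y). x \<otimes> y)"
    and continuous_inv: "continuous_map T T (\<lambda>x. inv x)"

text \<open>As usual, a locally compact group is Hausdorff.\<close>

locale locally_compact_group = topological_group +
  assumes locally_compact: "locally_compact_space T"
    and Hausdorff: "Hausdorff_space T"

definition compactly_generated :: "('g, 'm) monoid_scheme \<Rightarrow> 'g topology \<Rightarrow> bool"
  where "compactly_generated G T \<longleftrightarrow> (\<exists>K. compactin T K \<and> generate G K = carrier G)"

definition topological_group_morphism ::
    "('g, 'm) monoid_scheme \<Rightarrow> 'g topology \<Rightarrow> ('q, 'n) monoid_scheme \<Rightarrow> 'q topology \<Rightarrow> ('g \<Rightarrow> 'q) \<Rightarrow> bool"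
  where "topological_group_morphism G T Q S f \<longleftrightarrow> f \<in> hom G Q \<and> continuous_map T S f"


section \<open>Complex Hilbert spaces with an explicit carrier\<close>

definition complex_ring :: "complex ring"
  where "complex_ring = \<lparr>carrier = UNIV, mult = (*), one = 1, zero = 0, add = (+)\<rparr>"

text \<open>
  The fields for multiplication and unit inherited from the library's record of modules carry no
  information for a Hilbert space.
\<close>

record 'h hilbert = "(complex, 'h) module" +
  inner_prod :: "'h \<Rightarrow> 'h \<Rightarrow> complex"

definition hnorm :: "('h, 'm) hilbert_scheme \<Rightarrow> 'h \<Rightarrow> real"
  where "hnorm H x = sqrt (Re (inner_prod H x x))"

text \<open>
  The library's metric spaces require nonnegativity and symmetry of the distance also outside the
  carrier, hence the case distinction.
\<close>

definition hdist :: "('h, 'm) hilbert_scheme \<Rightarrow> 'h \<Rightarrow> 'h \<Rightarrow> real"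
  where "hdist H x y =
    (if x \<in> carrier H \<and> y \<in> carrier H then hnorm H (x \<ominus>\<^bsub>H\<^esub> y) else 0)"

definition htopology :: "('h, 'm) hilbert_scheme \<Rightarrow> 'h topology"
  where "htopology H = Metric_space.mtopology (carrier H) (hdist H)"

locale inner_product_space = module complex_ring H for H :: "('h, 'm) hilbert_scheme" (structure) +
  assumes inner_add_left: "\<lbrakk>x \<in> carrier H; y \<in> carrier H; z \<in> carrier H\<rbrakk> \<Longrightarrow>
      inner_prod H (x \<oplus> y) z = inner_prod H x z + inner_prod H y z"
    and inner_scale_left: "\<lbrakk>x \<in> carrier H; y \<in> carrier H\<rbrakk> \<Longrightarrow>
      inner_prod H (c \<odot> x) y = c * inner_prod H x y"
    and inner_commute: "\<lbrakk>x \<in> carrier H; y \<in> carrier H\<rbrakk> \<Longrightarrow>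
      inner_prod H y x = cnj (inner_prod H x y)"
    and inner_nonneg: "x \<in> carrier H \<Longrightarrow> 0 \<le> Re (inner_prod H x x)"
    and inner_definite: "\<lbrakk>x \<in> carrier H; inner_prod H x x = 0\<rbrakk> \<Longrightarrow> x = \<zero>"

locale hilbert_space = inner_product_space +
  assumes complete: "Metric_space.mcomplete (carrier H) (hdist H)"


section \<open>Unitary representations\<close>

text \<open>
  A group action on the carrier is a homomorphism into the group of its bijections, where
  bijections are undefined outside the carrier.  So \<open>\<pi> g\<close> is unitary once it is linear and
  preserves the inner product.
\<close>

locale unitary_representation =
  topological_group G T + hilbert_space H + group_action G "carrier H" \<pi>
  for G :: "('g, 'm) monoid_scheme" and T :: "'g topology"
    and H :: "('h, 'n) hilbert_scheme" and \<pi> :: "'g \<Rightarrow> 'h \<Rightarrow> 'h" +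
  assumes rep_add: "\<lbrakk>g \<in> carrier G; x \<in> carrier H; y \<in> carrier H\<rbrakk> \<Longrightarrow>
      \<pi> g (x \<oplus>\<^bsub>H\<^esub> y) = \<pi> g x \<oplus>\<^bsub>H\<^esub> \<pi> g y"
    and rep_scale: "\<lbrakk>g \<in> carrier G; x \<in> carrier H\<rbrakk> \<Longrightarrow>
      \<pi> g (c \<odot>\<^bsub>H\<^esub> x) = c \<odot>\<^bsub>H\<^esub> \<pi> g x"
    and rep_inner: "\<lbrakk>g \<in> carrier G; x \<in> carrier H; y \<in> carrier H\<rbrakk> \<Longrightarrow>
      inner_prod H (\<pi> g x) (\<pi> g y) = inner_prod H x y"
    and strongly_continuous: "x \<in> carrier H \<Longrightarrow> continuous_map T (htopology H) (\<lambda>g. \<pi> g x)"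

definition almost_has_invariant_vectors ::
    "'g topology \<Rightarrow> ('h, 'n) hilbert_scheme \<Rightarrow> ('g \<Rightarrow> 'h \<Rightarrow> 'h) \<Rightarrow> bool"
  where "almost_has_invariant_vectors T H \<pi> \<longleftrightarrow>
    (\<forall>K \<epsilon>. compactin T K \<and> \<epsilon> > 0 \<longrightarrow>
      (\<exists>\<xi> \<in> carrier H. \<xi> \<noteq> \<zero>\<^bsub>H\<^esub> \<and>
        (\<forall>g \<in> K. hnorm H (\<pi> g \<xi> \<ominus>\<^bsub>H\<^esub> \<xi>) \<le> \<epsilon> * hnorm H \<xi>)))"

definition invariant_subspace ::
    "('g, 'm) monoid_scheme \<Rightarrow> ('h, 'n) hilbert_scheme \<Rightarrow> ('g \<Rightarrow> 'h \<Rightarrow> 'h) \<Rightarrow> 'h set \<Rightarrow> bool"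
  where "invariant_subspace G H \<pi> W \<longleftrightarrow>
    submodule W complex_ring H \<and> closedin (htopology H) W \<and> (\<forall>g \<in> carrier G. \<pi> g ` W \<subseteq> W)"


section \<open>Resolutions\<close>

text \<open>
  A definition cannot quantify over the types carrying Hilbert spaces, so representations of a
  group with elements of type \<open>'g\<close> are taken on Hilbert spaces whose carrier is an arbitrary set
  (with arbitrary operations) of elements of the following type.  This is no restriction: let
  \<open>\<pi>\<close> be a unitary representation of \<open>G\<close>, on any Hilbert space, that almost has invariant vectors.
  For each compact set \<open>K\<close> and each \<open>n\<close> pick a nonzero vector moved by \<open>K\<close> by at most \<open>1/(n+1)\<close>
  times its norm.  The closed invariant subspace generated by these vectors almost has invariant
  vectors and has a dense subset of cardinality at most that of \<open>'g set \<times> nat\<close>, so it embeds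
  isometrically into the square summable functions \<open>'g set \<times> nat \<Rightarrow> complex\<close>; and a
  subrepresentation of it is one of \<open>\<pi>\<close>.
\<close>

type_synonym 'g universe = "'g set \<times> nat \<Rightarrow> complex"

text \<open>
  The subrepresentation of \<open>\<pi>\<close> on a closed invariant subspace \<open>W\<close> is \<open>\<lambda>g. restrict (\<pi> g) W\<close>,
  acting on the Hilbert space \<open>H\<lparr>carrier := W\<rparr>\<close>.
\<close>

definition resolution ::
    "('g, 'm) monoid_scheme \<Rightarrow> 'g topology \<Rightarrow> ('q, 'n) monoid_scheme \<Rightarrow> 'q topology \<Rightarrow> ('g \<Rightarrow> 'q) \<Rightarrow> bool"
  where "resolution G T Q S f \<longleftrightarrow>
    locally_compact_group G T \<and> locally_compact_group Q S \<and>
    topological_group_morphism G T Q S f \<and>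
    S closure_of (f ` carrier G) = carrier Q \<and>
    (\<forall>(H :: 'g universe hilbert) \<pi>.
      unitary_representation G T H \<pi> \<and> almost_has_invariant_vectors T H \<pi> \<longrightarrow>
      (\<exists>W \<rho>. invariant_subspace G H \<pi> W \<and> W \<noteq> {\<zero>\<^bsub>H\<^esub>} \<and>
        unitary_representation Q S (H\<lparr>carrier := W\<rparr>) \<rho> \<and>
        (\<forall>g \<in> carrier G. restrict (\<pi> g) W = \<rho> (f g)) \<and>
        almost_has_invariant_vectors S (H\<lparr>carrier := W\<rparr>) \<rho>))"

end

theory Submission
  imports Defs
begin

text \<open>
  If \<open>G\<close> is compactly generated, then \<open>Q\<close> is generated by the image of a compact generating set
  together with a compact neighbourhood of the identity.  For the converse, let \<open>G\<close> act on the set \<open>Y\<close>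
  of all left cosets of its open compactly generated subgroups.  Every compact subset of \<open>G\<close> lies
  in such a subgroup, so the permutation representation on \<open>\<ell>\<^sup>2(Y)\<close> almost has invariant
  vectors.  The resolution yields a nonzero vector \<open>\<xi>\<close> whose orbit map factors through a continuous map
  on \<open>Q\<close>; hence the elements of \<open>G\<close> mapped to a suitable neighbourhood \<open>V\<close> of the identity of \<open>Q\<close>
  move some coset only inside a finite set, which puts \<open>f\<^sup>-\<^sup>1(V)\<close> into a compactly
  generated subgroup.  Adjoining finitely many elements makes the image of this subgroup dense in
  \<open>Q\<close>, and a subgroup that contains \<open>f\<^sup>-\<^sup>1(V)\<close> and has dense image is all of \<open>G\<close>.
\<close>

section \<open>Cauchy-Schwarz, the triangle inequality and the metric of an inner product
  space\<close>

section \<open>Inner product spaces\<close>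

lemma complex_ring_simps [simp]:
  "carrier complex_ring = UNIV" "x \<otimes>\<^bsub>complex_ring\<^esub> y = x * y" "\<one>\<^bsub>complex_ring\<^esub> = 1"
  "\<zero>\<^bsub>complex_ring\<^esub> = 0" "x \<oplus>\<^bsub>complex_ring\<^esub> y = x + y"
  by (simp_all add: complex_ring_def)

lemma cring_complex_ring: "cring complex_ring"
proof (rule cringI)
  show "abelian_group complex_ring"
    by (rule abelian_groupI) (auto intro: exI[of _ "- x" for x])
  show "comm_monoid complex_ring"
    by (rule comm_monoidI) auto
qed (auto simp: algebra_simps)

context inner_product_space
begin

lemma inner_add_right:
  assumes "x \<in> carrier H" "y \<in> carrier H" "z \<in> carrier H"
  shows "inner_prod H x (y \<oplus> z) = inner_prod H x y + inner_prod H x z"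
proof -
  have "inner_prod H x (y \<oplus> z) = cnj (inner_prod H (y \<oplus> z) x)"
    using assms by (intro inner_commute) auto
  also have "\<dots> = cnj (inner_prod H y x) + cnj (inner_prod H z x)"
    using assms by (simp add: inner_add_left)
  finally show ?thesis
    using assms inner_commute by metis
qed

lemma inner_scale_right:
  assumes "x \<in> carrier H" "y \<in> carrier H"
  shows "inner_prod H x (c \<odot> y) = cnj c * inner_prod H x y"
proof -
  have "inner_prod H x (c \<odot> y) = cnj (inner_prod H (c \<odot> y) x)"
    using assms by (intro inner_commute) auto
  also have "\<dots> = cnj c * cnj (inner_prod H y x)"
    using assms by (simp add: inner_scale_left)
  finally show ?thesis
    using assms inner_commute by metis
qed

lemma inner_zero_left: "x \<in> carrier H \<Longrightarrow> inner_prod H \<zero> x = 0"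
  using inner_add_left[of \<zero> \<zero> x] by simp

lemma inner_minus_left:
  assumes "x \<in> carrier H" "y \<in> carrier H"
  shows "inner_prod H (\<ominus> x) y = - inner_prod H x y"
proof -
  have "inner_prod H (\<ominus> x) y + inner_prod H x y = inner_prod H (\<ominus> x \<oplus> x) y"
    using assms by (subst inner_add_left) auto
  also have "\<dots> = 0"
    using assms by (simp add: M.l_neg inner_zero_left)
  finally show ?thesis
    by (simp add: eq_neg_iff_add_eq_0)
qed

lemma inner_minus_right:
  assumes "x \<in> carrier H" "y \<in> carrier H"
  shows "inner_prod H x (\<ominus> y) = - inner_prod H x y"
proof -
  have "inner_prod H x (\<ominus> y) = cnj (inner_prod H (\<ominus> y) x)"
    using assms by (intro inner_commute) auto
  also have "\<dots> = - cnj (inner_prod H y x)"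
    using assms by (simp add: inner_minus_left)
  finally show ?thesis
    using assms inner_commute by metis
qed

lemma inner_self_real: "x \<in> carrier H \<Longrightarrow> Im (inner_prod H x x) = 0"
  by (metis inner_commute Reals_cnj_iff complex_is_Real_iff)

lemma hnorm_power2: "x \<in> carrier H \<Longrightarrow> (hnorm H x)\<^sup>2 = Re (inner_prod H x x)"
  using inner_nonneg by (simp add: hnorm_def)

lemma hnorm_nonneg: "x \<in> carrier H \<Longrightarrow> 0 \<le> hnorm H x"
  using inner_nonneg by (simp add: hnorm_def)

lemma hnorm_eq_0: "x \<in> carrier H \<Longrightarrow> hnorm H x = 0 \<longleftrightarrow> x = \<zero>"
  using inner_definite[of x] inner_self_real[of x] inner_zero_left[of \<zero>]
  by (auto simp: hnorm_def complex_eq_iff)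

lemma hnorm_minus: "x \<in> carrier H \<Longrightarrow> hnorm H (\<ominus> x) = hnorm H x"
  by (simp add: hnorm_def inner_minus_left inner_minus_right)

text \<open>For real t the squared norm of x + t y is a nonnegative quadratic polynomial in t, and
  its minimum gives the bound. The real part suffices because only the real part enters the
  expansion of the squared norm of a sum in \<open>hnorm_triangle\<close>.\<close>

lemma Cauchy_Schwarz_Re:
  assumes x: "x \<in> carrier H" and y: "y \<in> carrier H"
  shows "Re (inner_prod H x y) \<le> hnorm H x * hnorm H y"
proof (cases "y = \<zero>")
  case True
  then have "inner_prod H x y = 0"
    using x inner_zero_left[OF x] inner_commute[of \<zero> x] by simp
  then show ?thesis
    using hnorm_nonneg x y by simp
next
  case False
  \<comment> \<open>The minimiser of the quadratic polynomial; it is well defined because y is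
    nonzero in this case.\<close>
  define t where "t = - (Re (inner_prod H x y) / (hnorm H y)\<^sup>2)"
  have n: "hnorm H y > 0"
    using False y hnorm_eq_0 hnorm_nonneg by (simp add: less_le)
  have sym: "Re (inner_prod H y x) = Re (inner_prod H x y)"
    by (subst inner_commute[OF x y]) simp
  have "0 \<le> Re (inner_prod H (x \<oplus> of_real t \<odot> y) (x \<oplus> of_real t \<odot> y))"
    using x y by (intro inner_nonneg) auto
  also have "\<dots> = (hnorm H x)\<^sup>2 + 2 * t * Re (inner_prod H x y) + t\<^sup>2 * (hnorm H y)\<^sup>2"
    using x y sym
    unfolding hnorm_power2[OF x] hnorm_power2[OF y]
    by (simp add: inner_add_left inner_add_right inner_scale_left inner_scale_right
        algebra_simps power2_eq_square)
  also have "\<dots> = (hnorm H x)\<^sup>2 - (Re (inner_prod H x y))\<^sup>2 / (hnorm H y)\<^sup>2"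
    using n by (simp add: t_def field_simps power2_eq_square)
  finally have "(Re (inner_prod H x y))\<^sup>2 \<le> (hnorm H x * hnorm H y)\<^sup>2"
    using n pos_divide_le_eq[of "(hnorm H y)\<^sup>2" "(Re (inner_prod H x y))\<^sup>2" "(hnorm H x)\<^sup>2"]
    unfolding power_mult_distrib by (metis diff_ge_0_iff_ge zero_less_power)
  then show ?thesis
    by (rule power2_le_imp_le) (intro mult_nonneg_nonneg hnorm_nonneg x y)
qed

lemma hnorm_triangle:
  assumes x: "x \<in> carrier H" and y: "y \<in> carrier H"
  shows "hnorm H (x \<oplus> y) \<le> hnorm H x + hnorm H y"
proof -
  have "(hnorm H (x \<oplus> y))\<^sup>2 = (hnorm H x)\<^sup>2 + 2 * Re (inner_prod H x y) + (hnorm H y)\<^sup>2"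
    using x y arg_cong[OF inner_commute[OF x y], of Re]
    by (simp add: hnorm_power2 inner_add_left inner_add_right)
  also have "\<dots> \<le> (hnorm H x + hnorm H y)\<^sup>2"
    using Cauchy_Schwarz_Re[OF x y] by (simp add: power2_sum)
  finally show ?thesis
    by (rule power2_le_imp_le) (intro add_nonneg_nonneg hnorm_nonneg x y)
qed

lemma Metric_space_hdist: "Metric_space (carrier H) (hdist H)"
proof
  fix x y
  show "0 \<le> hdist H x y"
    by (simp add: hdist_def hnorm_nonneg)
  have "hnorm H (x \<ominus> y) = hnorm H (y \<ominus> x)" if "x \<in> carrier H" "y \<in> carrier H"
    using that hnorm_minus[of "x \<ominus> y"] by (simp add: M.minus_eq M.minus_add M.a_comm)
  then show "hdist H x y = hdist H y x"
    by (simp add: hdist_def)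
  show "hdist H x y = 0 \<longleftrightarrow> x = y" if xy: "x \<in> carrier H" "y \<in> carrier H"
  proof
    assume "hdist H x y = 0"
    then have "x \<oplus> \<ominus> y = \<zero>"
      using xy hnorm_eq_0[of "x \<ominus> y"] by (simp add: hdist_def M.minus_eq)
    then have "\<ominus> (\<ominus> y) = x"
      using xy by (intro M.minus_equality) auto
    then show "x = y"
      using xy by simp
  qed (use xy hnorm_eq_0[of \<zero>] in \<open>simp add: hdist_def M.minus_eq M.r_neg\<close>)
  fix z
  show "hdist H x z \<le> hdist H x y + hdist H y z"
    if "x \<in> carrier H" "y \<in> carrier H" "z \<in> carrier H"
  proof -
    have "x \<ominus> z = (x \<ominus> y) \<oplus> (y \<ominus> z)"
      using that by (simp add: M.minus_eq M.a_assoc M.r_neg1)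
    then show ?thesis
      using that hnorm_triangle[of "x \<ominus> y" "y \<ominus> z"] by (simp add: hdist_def)
  qed
qed

end

section \<open>The Hilbert space of square summable complex functions on a set\<close>

section \<open>Square summable functions\<close>

text \<open>The functions live on the whole index type and vanish off \<open>Y\<close>, so that
  equality of functions is equality in the space. For the index type
  \<open>'g set \<times> nat\<close> the vectors have type \<open>'g universe\<close>, as
  \<open>resolution\<close> demands.\<close>

definition ell2 :: "'i set \<Rightarrow> ('i \<Rightarrow> complex) hilbert"
  where "ell2 Y = \<lparr>carrier = {u. (\<forall>i. i \<notin> Y \<longrightarrow> u i = 0) \<and> (\<lambda>i. (cmod (u i))\<^sup>2) summable_on Y},
    mult = undefined, one = undefined, zero = (\<lambda>i. 0), add = (\<lambda>u v i. u i + v i),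
    smult = (\<lambda>c u i. c * u i), inner_prod = (\<lambda>u v. \<Sum>\<^sub>\<infinity>i\<in>Y. u i * cnj (v i))\<rparr>"

lemma ell2_simps [simp]:
  "u \<in> carrier (ell2 Y) \<longleftrightarrow> (\<forall>i. i \<notin> Y \<longrightarrow> u i = 0) \<and> (\<lambda>i. (cmod (u i))\<^sup>2) summable_on Y"
  "\<zero>\<^bsub>ell2 Y\<^esub> = (\<lambda>i. 0)" "u \<oplus>\<^bsub>ell2 Y\<^esub> v = (\<lambda>i. u i + v i)" "c \<odot>\<^bsub>ell2 Y\<^esub> u = (\<lambda>i. c * u i)"
  "inner_prod (ell2 Y) u v = (\<Sum>\<^sub>\<infinity>i\<in>Y. u i * cnj (v i))"
  by (simp_all add: ell2_def)

lemma cmod_add_power2_le: "(cmod (a + b))\<^sup>2 \<le> 2 * (cmod a)\<^sup>2 + 2 * (cmod b)\<^sup>2"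
proof -
  have "(cmod (a + b))\<^sup>2 \<le> (cmod a + cmod b)\<^sup>2"
    by (intro power_mono norm_triangle_ineq) auto
  also have "\<dots> \<le> 2 * (cmod a)\<^sup>2 + 2 * (cmod b)\<^sup>2"
    using sum_squares_bound[of "cmod a" "cmod b"] by (simp add: power2_sum)
  finally show ?thesis .
qed

lemma square_summable_add:
  assumes "(\<lambda>i. (cmod (u i))\<^sup>2) summable_on Y" "(\<lambda>i. (cmod (v i))\<^sup>2) summable_on Y"
  shows "(\<lambda>i. (cmod (u i + v i))\<^sup>2) summable_on Y"
  by (rule summable_on_comparison_test[where f = "\<lambda>i. 2 * (cmod (u i))\<^sup>2 + 2 * (cmod (v i))\<^sup>2"])
    (use assms cmod_add_power2_le in \<open>auto intro!: summable_on_add summable_on_cmult_right\<close>)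

lemma square_summable_scale:
  assumes "(\<lambda>i. (cmod (u i))\<^sup>2) summable_on Y"
  shows "(\<lambda>i. (cmod (c * u i))\<^sup>2) summable_on Y"
  unfolding norm_mult power_mult_distrib by (intro summable_on_cmult_right assms)

lemma square_summable_inner:
  assumes "(\<lambda>i. (cmod (u i))\<^sup>2) summable_on Y" "(\<lambda>i. (cmod (v i))\<^sup>2) summable_on Y"
  shows "(\<lambda>i. u i * cnj (v i)) summable_on Y"
proof -
  have "(\<lambda>i. cmod (u i * cnj (v i))) summable_on Y"
  proof (rule summable_on_comparison_test)
    show "(\<lambda>i. (cmod (u i))\<^sup>2 + (cmod (v i))\<^sup>2) summable_on Y"
      by (intro summable_on_add assms)
    show "cmod (u i * cnj (v i)) \<le> (cmod (u i))\<^sup>2 + (cmod (v i))\<^sup>2" if "i \<in> Y" for i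
    proof -
      have "0 \<le> cmod (u i) * cmod (v i)"
        by simp
      with sum_squares_bound[of "cmod (u i)" "cmod (v i)"]
      have "cmod (u i) * cmod (v i) \<le> (cmod (u i))\<^sup>2 + (cmod (v i))\<^sup>2"
        by linarith
      then show ?thesis
        by (simp only: norm_mult complex_mod_cnj)
    qed
  qed simp
  then show ?thesis
    by (rule abs_summable_summable)
qed

lemma inner_ell2_self:
  assumes "u \<in> carrier (ell2 Y)"
  shows "inner_prod (ell2 Y) u u = of_real (\<Sum>\<^sub>\<infinity>i\<in>Y. (cmod (u i))\<^sup>2)"
proof -
  have "((\<lambda>i. complex_of_real ((cmod (u i))\<^sup>2)) has_sum
      of_real (\<Sum>\<^sub>\<infinity>i\<in>Y. (cmod (u i))\<^sup>2)) Y"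
    using assms by (intro has_sum_of_real) simp
  then show ?thesis
    by (simp only: ell2_simps complex_norm_square infsumI)
qed

lemma hnorm_ell2:
  assumes "u \<in> carrier (ell2 Y)"
  shows "hnorm (ell2 Y) u = sqrt (\<Sum>\<^sub>\<infinity>i\<in>Y. (cmod (u i))\<^sup>2)"
  unfolding hnorm_def inner_ell2_self[OF assms] by simp

lemma cmod_le_hnorm_ell2:
  assumes "u \<in> carrier (ell2 Y)"
  shows "cmod (u i) \<le> hnorm (ell2 Y) u"
proof (cases "i \<in> Y")
  case True
  have "(\<Sum>j\<in>{i}. (cmod (u j))\<^sup>2) \<le> (\<Sum>\<^sub>\<infinity>j\<in>Y. (cmod (u j))\<^sup>2)"
    using assms True by (intro finite_sum_le_infsum) auto
  then show ?thesis
    unfolding hnorm_ell2[OF assms] by (intro real_le_rsqrt) simp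
next
  case False
  then show ?thesis
    using assms hnorm_ell2[OF assms] by (simp add: infsum_nonneg)
qed

lemma ell2_inner_product_space: "inner_product_space (ell2 Y)"
proof -
  have ab: "abelian_group (ell2 Y)"
  proof (rule abelian_groupI)
    fix u assume "u \<in> carrier (ell2 Y)"
    then show "\<exists>v\<in>carrier (ell2 Y). v \<oplus>\<^bsub>ell2 Y\<^esub> u = \<zero>\<^bsub>ell2 Y\<^esub>"
      by (intro bexI[of _ "\<lambda>i. - u i"]) auto
  qed (auto simp: square_summable_add add_ac)
  have mod: "module complex_ring (ell2 Y)"
    by (rule moduleI[OF cring_complex_ring ab])
      (auto simp: square_summable_scale algebra_simps)
  have "inner_product_space_axioms (ell2 Y)"
  proof
    fix u v w :: "'a \<Rightarrow> complex" and c
    assume u: "u \<in> carrier (ell2 Y)"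
    show "0 \<le> Re (inner_prod (ell2 Y) u u)"
      unfolding inner_ell2_self[OF u] by (simp add: infsum_nonneg)
    show "u = \<zero>\<^bsub>ell2 Y\<^esub>" if "inner_prod (ell2 Y) u u = 0"
    proof -
      have "hnorm (ell2 Y) u = 0"
        using that by (simp only: hnorm_def) simp
      then show ?thesis
        using cmod_le_hnorm_ell2[OF u] by auto
    qed
    assume v: "v \<in> carrier (ell2 Y)"
    show "inner_prod (ell2 Y) (c \<odot>\<^bsub>ell2 Y\<^esub> u) v = c * inner_prod (ell2 Y) u v"
      by (simp add: mult.assoc infsum_cmult_right')
    show "inner_prod (ell2 Y) v u = cnj (inner_prod (ell2 Y) u v)"
      by (simp add: infsum_cnj[symmetric] mult.commute del: infsum_cnj)
    assume w: "w \<in> carrier (ell2 Y)"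
    show "inner_prod (ell2 Y) (u \<oplus>\<^bsub>ell2 Y\<^esub> v) w = inner_prod (ell2 Y) u w + inner_prod (ell2 Y) v w"
      using u v w by (simp add: distrib_right infsum_add square_summable_inner)
  qed
  with mod show ?thesis
    by (simp add: inner_product_space_def)
qed

text \<open>Additive inverses are defined relative to the carrier, so subtraction in a subspace
  \<open>W\<close> has to be identified anew with pointwise subtraction. The equation -v + v = 0
  inside \<open>W\<close>, read at each index, does this.\<close>

lemma ell2_minus:
  assumes W: "abelian_group (ell2 Y\<lparr>carrier := W\<rparr>)" and "u \<in> W" "v \<in> W"
  shows "u \<ominus>\<^bsub>ell2 Y\<lparr>carrier := W\<rparr>\<^esub> v = (\<lambda>i. u i - v i)"
proof -
  interpret abelian_group "ell2 Y\<lparr>carrier := W\<rparr>" by fact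
  have "\<ominus>\<^bsub>ell2 Y\<lparr>carrier := W\<rparr>\<^esub> v \<oplus>\<^bsub>ell2 Y\<lparr>carrier := W\<rparr>\<^esub> v = \<zero>\<^bsub>ell2 Y\<lparr>carrier := W\<rparr>\<^esub>"
    using assms by (intro l_neg) simp
  then have "(\<ominus>\<^bsub>ell2 Y\<lparr>carrier := W\<rparr>\<^esub> v) i = - v i" for i
    by (simp add: fun_eq_iff eq_neg_iff_add_eq_0)
  then show ?thesis
    by (simp add: minus_eq)
qed

lemma ell2_carrier_update: "ell2 Y\<lparr>carrier := carrier (ell2 Y)\<rparr> = ell2 Y"
  by simp

text \<open>The general \<open>W\<close> serves both the subrepresentation and, through
  \<open>ell2_carrier_update\<close>, the full space.\<close>

lemma hdist_ell2:
  assumes "abelian_group (ell2 Y\<lparr>carrier := W\<rparr>)" "u \<in> W" "v \<in> W"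
  shows "hdist (ell2 Y\<lparr>carrier := W\<rparr>) u v = hnorm (ell2 Y) (\<lambda>i. u i - v i)"
  using assms by (simp add: hdist_def ell2_minus) (simp add: hnorm_def)

text \<open>Evaluation at an index does not increase distances, so a Cauchy sequence converges
  pointwise. The remaining work is to show that the pointwise limit is square summable and is a
  limit in norm.\<close>

lemma ell2_complete: "Metric_space.mcomplete (carrier (ell2 Y)) (hdist (ell2 Y))"
proof -
  interpret inner_product_space "ell2 Y" by (rule ell2_inner_product_space)
  interpret Metric_space "carrier (ell2 Y)" "hdist (ell2 Y)" by (rule Metric_space_hdist)
  have d: "hdist (ell2 Y) u v = hnorm (ell2 Y) (\<lambda>i. u i - v i)"
    if "u \<in> carrier (ell2 Y)" "v \<in> carrier (ell2 Y)" for u v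
    using hdist_ell2[where Y = Y and W = "carrier (ell2 Y)"] that M.abelian_group_axioms
    by (simp only: ell2_carrier_update)
  have diff: "(\<lambda>i. u i - v i) \<in> carrier (ell2 Y)"
    if "u \<in> carrier (ell2 Y)" "v \<in> carrier (ell2 Y)" for u v
    using that square_summable_add[of u Y "\<lambda>i. - v i"] by auto
  show ?thesis
    unfolding mcomplete_def
  proof (intro allI impI)
    fix \<sigma> assume "MCauchy \<sigma>"
    then have \<sigma>: "\<sigma> n \<in> carrier (ell2 Y)"
      and cau: "\<And>\<epsilon>. \<epsilon> > 0 \<Longrightarrow> \<exists>N. \<forall>n n'. N \<le> n \<longrightarrow> N \<le> n' \<longrightarrow> hdist (ell2 Y) (\<sigma> n) (\<sigma> n') < \<epsilon>" for n
      unfolding MCauchy_def by blast+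
    have dist_le: "dist (\<sigma> n i) (\<sigma> m i) \<le> hdist (ell2 Y) (\<sigma> n) (\<sigma> m)" for n m i
      using cmod_le_hnorm_ell2[OF diff[OF \<sigma> \<sigma>]] d[OF \<sigma> \<sigma>] by (simp only: dist_norm)
    have "Cauchy (\<lambda>n. \<sigma> n i)" for i
      unfolding Cauchy_def by (meson cau dist_le le_less_trans)
    then have "\<forall>i. \<exists>l. (\<lambda>n. \<sigma> n i) \<longlonglongrightarrow> l"
      by (simp add: Cauchy_convergent_iff convergent_def)
    then obtain u where u: "\<And>i. (\<lambda>n. \<sigma> n i) \<longlonglongrightarrow> u i"
      by metis
    have u0: "u i = 0" if "i \<notin> Y" for i
    proof -
      have "(\<lambda>n. \<sigma> n i) = (\<lambda>n. 0)"
        using \<sigma> that by auto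
      with u[of i] show ?thesis
        by (simp add: LIMSEQ_const_iff)
    qed
    have key: "\<exists>N. \<forall>n\<ge>N. u \<in> carrier (ell2 Y) \<and> hnorm (ell2 Y) (\<lambda>i. \<sigma> n i - u i) \<le> \<epsilon>"
      if \<epsilon>: "\<epsilon> > 0" for \<epsilon>
    proof -
      obtain N where N: "\<And>n m. N \<le> n \<Longrightarrow> N \<le> m \<Longrightarrow> hdist (ell2 Y) (\<sigma> n) (\<sigma> m) < \<epsilon>"
        using cau[OF \<epsilon>] by blast
      have "u \<in> carrier (ell2 Y) \<and> hnorm (ell2 Y) (\<lambda>i. \<sigma> n i - u i) \<le> \<epsilon>" if n: "n \<ge> N" for n
      proof -
        \<comment> \<open>A finite partial sum passes to the pointwise limit in m. As the bound does
          not depend on \<open>F\<close>, it yields both the summability of the tail difference and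
          the norm estimate.\<close>
        have fin: "(\<Sum>i\<in>F. (cmod (\<sigma> n i - u i))\<^sup>2) \<le> \<epsilon>\<^sup>2" if F: "finite F" "F \<subseteq> Y" for F
        proof (rule tendsto_upperbound)
          show "(\<lambda>m. \<Sum>i\<in>F. (cmod (\<sigma> n i - \<sigma> m i))\<^sup>2) \<longlonglongrightarrow> (\<Sum>i\<in>F. (cmod (\<sigma> n i - u i))\<^sup>2)"
            by (intro tendsto_intros u)
          have "(\<Sum>i\<in>F. (cmod (\<sigma> n i - \<sigma> m i))\<^sup>2) \<le> \<epsilon>\<^sup>2" if "m \<ge> N" for m
          proof -
            have "(\<Sum>i\<in>F. (cmod (\<sigma> n i - \<sigma> m i))\<^sup>2) \<le> (\<Sum>\<^sub>\<infinity>i\<in>Y. (cmod (\<sigma> n i - \<sigma> m i))\<^sup>2)"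
              using diff[OF \<sigma> \<sigma>, of n m] F by (intro finite_sum_le_infsum) auto
            also have "\<dots> = (hdist (ell2 Y) (\<sigma> n) (\<sigma> m))\<^sup>2"
              unfolding d[OF \<sigma> \<sigma>] hnorm_ell2[OF diff[OF \<sigma> \<sigma>]] by (simp add: infsum_nonneg)
            also have "\<dots> \<le> \<epsilon>\<^sup>2"
              using N[OF n that] by (intro power_mono) auto
            finally show ?thesis .
          qed
          then show "\<forall>\<^sub>F m in sequentially. (\<Sum>i\<in>F. (cmod (\<sigma> n i - \<sigma> m i))\<^sup>2) \<le> \<epsilon>\<^sup>2"
            by (auto simp: eventually_sequentially)
        qed auto
        have sm: "(\<lambda>i. (cmod (\<sigma> n i - u i))\<^sup>2) summable_on Y"
          using fin by (intro nonneg_bdd_above_summable_on) (auto intro!: bdd_aboveI[of _ "\<epsilon>\<^sup>2"])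
        \<comment> \<open>The limit u is the sum of the square summable functions \<sigma> n and
          -(\<sigma> n - u).\<close>
        have "(\<lambda>i. (cmod (u i))\<^sup>2) summable_on Y"
          using square_summable_add[of "\<sigma> n" Y "\<lambda>i. - (\<sigma> n i - u i)"] \<sigma>[of n] sm
          by (simp add: norm_minus_commute)
        then have uc: "u \<in> carrier (ell2 Y)"
          using u0 by simp
        have "(\<Sum>\<^sub>\<infinity>i\<in>Y. (cmod (\<sigma> n i - u i))\<^sup>2) \<le> \<epsilon>\<^sup>2"
          using sm fin by (rule infsum_le_finite_sums)
        then have "hnorm (ell2 Y) (\<lambda>i. \<sigma> n i - u i) \<le> \<epsilon>"
          using \<epsilon> unfolding hnorm_ell2[OF diff[OF \<sigma> uc]]
          by (intro real_le_lsqrt) (auto simp: infsum_nonneg)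
        with uc show ?thesis ..
      qed
      then show ?thesis
        by blast
    qed
    have uc: "u \<in> carrier (ell2 Y)"
      using key[of 1] by auto
    have "limitin mtopology \<sigma> u sequentially"
      unfolding limitin_metric eventually_sequentially
    proof (intro conjI allI impI uc)
      fix \<epsilon> :: real assume "\<epsilon> > 0"
      then obtain N where N: "\<And>n. n \<ge> N \<Longrightarrow> hnorm (ell2 Y) (\<lambda>i. \<sigma> n i - u i) \<le> \<epsilon> / 2"
        using key[of "\<epsilon> / 2"] by auto
      show "\<exists>N. \<forall>n\<ge>N. \<sigma> n \<in> carrier (ell2 Y) \<and> hdist (ell2 Y) (\<sigma> n) u < \<epsilon>"
        using N \<sigma> d[OF \<sigma> uc] \<open>\<epsilon> > 0\<close> by (intro exI[of _ N]) fastforce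
    qed
    then show "\<exists>u. limitin mtopology \<sigma> u sequentially"
      by blast
  qed
qed

lemma ell2_hilbert_space: "hilbert_space (ell2 Y)"
  by (simp add: hilbert_space_def hilbert_space_axioms_def ell2_inner_product_space ell2_complete)

section \<open>Closures, open subgroups and a criterion for group actions\<close>

section \<open>Topological groups\<close>

context topological_group
begin

lemma continuous_map_mult:
  assumes "continuous_map X T f" "continuous_map X T g"
  shows "continuous_map X T (\<lambda>x. f x \<otimes> g x)"
proof -
  have "continuous_map X (prod_topology T T) (\<lambda>x. (f x, g x))"
    using assms by (simp add: continuous_map_pairedI)
  from continuous_map_compose[OF this continuous_mult] show ?thesis
    by (simp add: o_def)
qed

lemma continuous_map_inv:
  assumes "continuous_map X T f"
  shows "continuous_map X T (\<lambda>x. inv (f x))"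
  using continuous_map_compose[OF assms continuous_inv] by (simp add: o_def)

lemma openin_subset_carrier: "openin T U \<Longrightarrow> U \<subseteq> carrier G"
  using openin_subset topspace_eq by blast

lemma compactin_subset_carrier: "compactin T K \<Longrightarrow> K \<subseteq> carrier G"
  using compactin_subset_topspace topspace_eq by blast

lemma openin_carrier: "openin T (carrier G)"
  using openin_topspace[of T] by (simp add: topspace_eq)

lemma openin_preimage:
  assumes "continuous_map T T f" "openin T U"
  shows "openin T {x \<in> carrier G. f x \<in> U}"
  using openin_continuous_map_preimage[OF assms] by (simp add: topspace_eq)

lemma continuous_map_left_mult: "a \<in> carrier G \<Longrightarrow> continuous_map T T (\<lambda>x. a \<otimes> x)"
  by (intro continuous_map_mult) (auto simp: topspace_eq)

lemma continuous_map_right_mult: "a \<in> carrier G \<Longrightarrow> continuous_map T T (\<lambda>x. x \<otimes> a)"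
  by (intro continuous_map_mult) (auto simp: topspace_eq)

lemma continuous_map_div: "a \<in> carrier G \<Longrightarrow> continuous_map T T (\<lambda>x. inv x \<otimes> a)"
  by (intro continuous_map_mult continuous_map_inv) (auto simp: topspace_eq)

text \<open>The p with p^-1 q in \<open>U\<close> form a neighbourhood of q. Density is used below
  in this form: q = p u with p in \<open>A\<close> and u in \<open>U\<close>.\<close>

lemma closure_of_div:
  assumes q: "q \<in> T closure_of A" and U: "openin T U" "\<one> \<in> U"
  shows "\<exists>p\<in>A. inv p \<otimes> q \<in> U"
proof -
  have qG: "q \<in> carrier G"
    using q by (simp add: in_closure_of topspace_eq)
  have "openin T {p \<in> carrier G. inv p \<otimes> q \<in> U}"
    by (intro openin_preimage continuous_map_div qG U(1))
  moreover have "q \<in> {p \<in> carrier G. inv p \<otimes> q \<in> U}"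
    using qG U(2) by simp
  ultimately have "\<exists>p. p \<in> A \<and> p \<in> {p \<in> carrier G. inv p \<otimes> q \<in> U}"
    using q unfolding in_closure_of by (elim conjE allE impE) (rule conjI)
  then show ?thesis
    by blast
qed

text \<open>Continuous maps send closures into closures; this is applied to inversion on
  \<open>D\<close> and to multiplication on \<open>D \<times> D\<close>, whose closure is the
  product of the closures.\<close>

lemma subgroup_closure_of:
  assumes "subgroup D G"
  shows "subgroup (T closure_of D) G"
proof (rule subgroupI)
  interpret D: subgroup D G by fact
  show "T closure_of D \<subseteq> carrier G"
    by (simp add: closure_of_subset_topspace topspace_eq[symmetric])
  have "D \<subseteq> T closure_of D"
    by (intro closure_of_subset) (simp add: topspace_eq D.subset)
  then show "T closure_of D \<noteq> {}"
    using D.one_closed by blast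
  show "inv x \<in> T closure_of D" if "x \<in> T closure_of D" for x
  proof -
    have "inv x \<in> T closure_of ((\<lambda>x. inv x) ` D)"
      using continuous_map_image_closure_subset[OF continuous_inv, of D] that by blast
    also have "\<dots> \<subseteq> T closure_of D"
      by (intro closure_of_mono) auto
    finally show ?thesis .
  qed
  show "x \<otimes> y \<in> T closure_of D" if "x \<in> T closure_of D" "y \<in> T closure_of D" for x y
  proof -
    have "(x, y) \<in> prod_topology T T closure_of (D \<times> D)"
      using that by (simp add: closure_of_Times)
    then have "x \<otimes> y \<in> T closure_of ((\<lambda>(x, y). x \<otimes> y) ` (D \<times> D))"
      using continuous_map_image_closure_subset[OF continuous_mult, of "D \<times> D"] by force
    also have "\<dots> \<subseteq> T closure_of D"
      by (intro closure_of_mono) auto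
    finally show ?thesis .
  qed
qed

text \<open>Each a in \<open>D\<close> has the translate a \<open>U\<close> as a neighbourhood
  inside \<open>D\<close>.\<close>

lemma openin_subgroupI:
  assumes "subgroup D G" "openin T U" "\<one> \<in> U" "U \<subseteq> D"
  shows "openin T D"
proof (subst openin_subopen, intro ballI)
  fix a assume a: "a \<in> D"
  interpret D: subgroup D G by fact
  define V where "V = {x \<in> carrier G. inv a \<otimes> x \<in> U}"
  have "openin T V"
    unfolding V_def using a assms(2) by (intro openin_preimage continuous_map_left_mult) auto
  moreover have "a \<in> V"
    using a assms(3) by (simp add: V_def)
  moreover have "V \<subseteq> D"
  proof
    fix x assume "x \<in> V"
    then have x: "x \<in> carrier G" "inv a \<otimes> x \<in> D"
      using assms(4) by (auto simp: V_def)
    have "a \<otimes> (inv a \<otimes> x) \<in> D"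
      using a x(2) by (rule D.m_closed)
    then show "x \<in> D"
      using a x by (simp add: m_assoc[symmetric])
  qed
  ultimately show "\<exists>V. openin T V \<and> a \<in> V \<and> V \<subseteq> D"
    by blast
qed

end

context locally_compact_group
begin

lemma compact_neighbourhood_one:
  obtains U L where "openin T U" "compactin T L" "\<one> \<in> U" "U \<subseteq> L"
  using locally_compact one_closed unfolding locally_compact_space_def topspace_eq by meson

text \<open>Adding a compact neighbourhood of the identity to \<open>K\<close> keeps the generating
  set compact and makes the generated subgroup open.\<close>

lemma compact_subset_open_compactly_generated:
  assumes "compactin T K"
  obtains C where "compactin T C" "K \<subseteq> generate G C" "openin T (generate G C)"
proof -
  obtain U L where UL: "openin T U" "compactin T L" "\<one> \<in> U" "U \<subseteq> L"
    by (rule compact_neighbourhood_one)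
  have C: "compactin T (K \<union> L)"
    using assms UL by (simp add: compactin_Un)
  show thesis
  proof
    show "openin T (generate G (K \<union> L))"
      using UL C by (intro openin_subgroupI[OF generate_is_subgroup] compactin_subset_carrier)
        (auto intro: generate.incl)
  qed (use C in \<open>auto intro: generate.incl\<close>)
qed

end

text \<open>Bijectivity comes for free, since the inverse of g acts as a two-sided inverse.
  Extensionality is demanded because elements of \<open>Bij E\<close> are undefined off
  \<open>E\<close>.\<close>

lemma (in group) group_actionI:
  assumes closed: "\<And>g x. g \<in> carrier G \<Longrightarrow> x \<in> E \<Longrightarrow> \<phi> g x \<in> E"
    and ext: "\<And>g. g \<in> carrier G \<Longrightarrow> \<phi> g \<in> extensional E"
    and one: "\<And>x. x \<in> E \<Longrightarrow> \<phi> \<one> x = x"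
    and mult: "\<And>g h x. g \<in> carrier G \<Longrightarrow> h \<in> carrier G \<Longrightarrow> x \<in> E \<Longrightarrow> \<phi> (g \<otimes> h) x = \<phi> g (\<phi> h x)"
  shows "group_action G E \<phi>"
proof -
  have Bij: "\<phi> g \<in> Bij E" if "g \<in> carrier G" for g
  proof -
    have "\<phi> (inv g) (\<phi> g x) = x" "\<phi> g (\<phi> (inv g) x) = x" if "x \<in> E" for x
      using mult[of "inv g" g x] mult[of g "inv g" x] one \<open>g \<in> carrier G\<close> that by auto
    then have "bij_betw (\<phi> g) E E"
      using closed that by (intro bij_betw_byWitness[where f' = "\<phi> (inv g)"]) auto
    then show ?thesis
      using ext that by (simp add: Bij_def)
  qed
  have "\<phi> (g \<otimes> h) = compose E (\<phi> g) (\<phi> h)" if "g \<in> carrier G" "h \<in> carrier G" for g h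
    using that ext[of "g \<otimes> h"] mult by (intro extensionalityI[where A = E]) (auto simp: compose_def)
  with Bij have "\<phi> \<in> hom G (BijGroup E)"
    by (intro homI) (auto simp: BijGroup_def)
  then show ?thesis
    by (simp add: group_action_def group_hom_def group_hom_axioms_def is_group group_BijGroup)
qed

section \<open>Unitarity, almost invariant vectors and finite sets of translates\<close>

section \<open>Permutation representations\<close>

text \<open>The inverse makes this a left action. The outer restriction gives an extensional map, as
  actions require, and the inner conditional keeps the values zero off \<open>Y\<close>.\<close>

definition permutation_rep ::
    "('g, 'm) monoid_scheme \<Rightarrow> 'i set \<Rightarrow> ('g \<Rightarrow> 'i \<Rightarrow> 'i) \<Rightarrow> 'g \<Rightarrow> ('i \<Rightarrow> complex) \<Rightarrow> 'i \<Rightarrow> complex"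
  where "permutation_rep G Y \<alpha> g =
    (\<lambda>u\<in>carrier (ell2 Y). \<lambda>i. if i \<in> Y then u (\<alpha> (inv\<^bsub>G\<^esub> g) i) else 0)"

context group_action
begin

interpretation group G
  using group_hom by (simp add: group_hom_def)

lemma permutation_rep_apply:
  "u \<in> carrier (ell2 Y) \<Longrightarrow> permutation_rep G Y \<alpha> g u = (\<lambda>i. if i \<in> Y then u (\<alpha> (inv g) i) else 0)"
  by (simp add: permutation_rep_def)

lemma bij_betw_inv_action: "g \<in> carrier G \<Longrightarrow> bij_betw (\<phi> (inv g)) E E"
  using bij_prop0[of "inv g"] by (simp add: Bij_def)

lemma permutation_rep_closed:
  assumes "g \<in> carrier G" "u \<in> carrier (ell2 E)"
  shows "permutation_rep G E \<phi> g u \<in> carrier (ell2 E)"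
proof -
  have "(\<lambda>i. (cmod (u (\<phi> (inv g) i)))\<^sup>2) summable_on E"
    using summable_on_reindex_bij_betw[OF bij_betw_inv_action, of g "\<lambda>i. (cmod (u i))\<^sup>2"] assms by simp
  then show ?thesis
    using assms(2) by (simp add: permutation_rep_apply cong: summable_on_cong)
qed

lemma inner_permutation_rep:
  assumes "g \<in> carrier G" "u \<in> carrier (ell2 E)" "v \<in> carrier (ell2 E)"
  shows "inner_prod (ell2 E) (permutation_rep G E \<phi> g u) (permutation_rep G E \<phi> g v)
    = inner_prod (ell2 E) u v"
proof -
  have "(\<Sum>\<^sub>\<infinity>i\<in>E. u (\<phi> (inv g) i) * cnj (v (\<phi> (inv g) i))) = (\<Sum>\<^sub>\<infinity>i\<in>E. u i * cnj (v i))"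
    using infsum_reindex_bij_betw[OF bij_betw_inv_action, of g "\<lambda>i. u i * cnj (v i)"] assms by simp
  then show ?thesis
    unfolding permutation_rep_apply[OF assms(2)] permutation_rep_apply[OF assms(3)]
    by (simp cong: infsum_cong)
qed

lemma group_action_permutation_rep:
  "group_action G (carrier (ell2 E)) (permutation_rep G E \<phi>)"
proof (rule group_actionI)
  fix g h u assume g: "g \<in> carrier G" and h: "h \<in> carrier G" and u: "u \<in> carrier (ell2 E)"
  have "\<phi> (inv (g \<otimes> h)) i = \<phi> (inv h) (\<phi> (inv g) i)" if "i \<in> E" for i
    using composition_rule[OF that, of "inv h" "inv g"] g h by (simp add: inv_mult_group)
  moreover have "\<phi> (inv g) i \<in> E" if "i \<in> E" for i
    using element_image[OF _ that refl, of "inv g"] g by simp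
  ultimately show "permutation_rep G E \<phi> (g \<otimes> h) u
      = permutation_rep G E \<phi> g (permutation_rep G E \<phi> h u)"
    unfolding permutation_rep_apply[OF permutation_rep_closed[OF h u]] 
    unfolding permutation_rep_apply[OF u] by auto
next
  fix u assume u: "u \<in> carrier (ell2 E)"
  have "\<phi> \<one> i = i" if "i \<in> E" for i
    using id_eq_one that by (metis restrict_apply')
  then show "permutation_rep G E \<phi> \<one> u = u"
    using u unfolding permutation_rep_apply[OF u] by auto
qed (use permutation_rep_closed in \<open>auto simp: permutation_rep_def\<close>)

end

text \<open>This is strong continuity at the identity. A finite set \<open>F\<close> carries all but
  \<epsilon>^2 / 8 of the squared norm of w. The elements fixing \<open>F\<close> pointwise form an
  open set; they leave w unchanged on \<open>F\<close> and, being unitary, preserve the squared norm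
  of the rest.\<close>

lemma permutation_rep_near_one:
  assumes "topological_group G T" "group_action G Y \<alpha>"
    and stab: "\<And>i. i \<in> Y \<Longrightarrow> openin T (stabilizer G \<alpha> i)"
    and w: "w \<in> carrier (ell2 Y)" and \<epsilon>: "\<epsilon> > 0"
  obtains U where "openin T U" "\<one>\<^bsub>G\<^esub> \<in> U"
    "\<And>h. h \<in> U \<Longrightarrow> hnorm (ell2 Y) (\<lambda>i. permutation_rep G Y \<alpha> h w i - w i) < \<epsilon>"
proof -
  interpret topological_group G T by fact
  interpret action: group_action G Y \<alpha> by fact
  let ?n = "\<lambda>u A. \<Sum>\<^sub>\<infinity>i\<in>A. (cmod (u i))\<^sup>2"
  have sw: "(\<lambda>i. (cmod (w i))\<^sup>2) summable_on Y"
    using w by simp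
  obtain F where F: "finite F" "F \<subseteq> Y" and dist: "dist (\<Sum>i\<in>F. (cmod (w i))\<^sup>2) (?n w Y) \<le> \<epsilon>\<^sup>2 / 8"
    using infsum_finite_approximation[OF sw, of "\<epsilon>\<^sup>2 / 8"] \<epsilon> by auto
  have "?n w (Y - F) = ?n w Y - (\<Sum>i\<in>F. (cmod (w i))\<^sup>2)"
    using infsum_Diff[OF sw, of F] F by simp
  with dist have small: "?n w (Y - F) \<le> \<epsilon>\<^sup>2 / 8"
    unfolding dist_real_def by linarith
  \<comment> \<open>For empty \<open>F\<close> the intersection of the stabilizers is the whole
    type, hence the intersection with \<open>carrier G\<close>.\<close>
  define U where "U = carrier G \<inter> (\<Inter>i\<in>F. stabilizer G \<alpha> i)"
  show thesis
  proof
    show "openin T U"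
      unfolding U_def using F stab openin_carrier
      by (cases "F = {}") (auto intro!: openin_Int openin_Inter)
    have "\<alpha> \<one>\<^bsub>G\<^esub> i = i" if "i \<in> Y" for i
      using action.id_eq_one that by (metis restrict_apply')
    then show "\<one>\<^bsub>G\<^esub> \<in> U"
      using F by (auto simp: U_def stabilizer_def)
    fix h assume h: "h \<in> U"
    then have hG: "h \<in> carrier G"
      by (simp add: U_def)
    define v where "v = permutation_rep G Y \<alpha> h w"
    have v: "v \<in> carrier (ell2 Y)"
      unfolding v_def by (rule action.permutation_rep_closed[OF hG w])
    then have sv: "(\<lambda>i. (cmod (v i))\<^sup>2) summable_on Y"
      by simp
    have vF: "v i = w i" if "i \<in> F" for i
    proof -
      have "\<alpha> h i = i"
        using h that by (auto simp: U_def stabilizer_def)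
      then have "\<alpha> (inv\<^bsub>G\<^esub> h) i = i"
        using action.orbit_sym_aux[OF hG, of i i] that F by auto
      then show ?thesis
        using that F by (auto simp: v_def action.permutation_rep_apply[OF w])
    qed
    have "(hnorm (ell2 Y) v)\<^sup>2 = (hnorm (ell2 Y) w)\<^sup>2"
      unfolding v_def hnorm_def action.inner_permutation_rep[OF hG w w] ..
    then have "?n v Y = ?n w Y"
      by (simp add: hnorm_ell2[OF v] hnorm_ell2[OF w] infsum_nonneg)
    \<comment> \<open>The total squared norms agree and so do the parts over \<open>F\<close>; hence
      the tails have equal squared norm.\<close>
    then have vw: "?n v (Y - F) = ?n w (Y - F)"
      using F infsum_Diff[OF sw, of F] infsum_Diff[OF sv, of F] vF by simp
    have svF: "(\<lambda>i. (cmod (v i))\<^sup>2) summable_on (Y - F)" and swF: "(\<lambda>i. (cmod (w i))\<^sup>2) summable_on (Y - F)"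
      using sv sw by (auto intro: summable_on_subset)
    have minus: "(\<lambda>i. v i - w i) \<in> carrier (ell2 Y)"
      using v w square_summable_add[of v Y "\<lambda>i. - w i"] by simp
    have "?n (\<lambda>i. v i - w i) Y = ?n (\<lambda>i. v i - w i) (Y - F)"
      using vF by (intro infsum_cong_neutral) auto
    also have "\<dots> \<le> (\<Sum>\<^sub>\<infinity>i\<in>Y - F. 2 * (cmod (v i))\<^sup>2 + 2 * (cmod (w i))\<^sup>2)"
    proof (rule infsum_mono)
      show "(\<lambda>i. (cmod (v i - w i))\<^sup>2) summable_on (Y - F)"
        using minus by (auto intro: summable_on_subset)
      show "(\<lambda>i. 2 * (cmod (v i))\<^sup>2 + 2 * (cmod (w i))\<^sup>2) summable_on (Y - F)"
        by (intro summable_on_add summable_on_cmult_right svF swF)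
      show "(cmod (v i - w i))\<^sup>2 \<le> 2 * (cmod (v i))\<^sup>2 + 2 * (cmod (w i))\<^sup>2" for i
        using cmod_add_power2_le[of "v i" "- w i"] by simp
    qed
    also have "\<dots> = 2 * ?n v (Y - F) + 2 * ?n w (Y - F)"
      by (simp add: infsum_add infsum_cmult_right' summable_on_cmult_right svF swF)
    \<comment> \<open>Both tails are at most \<epsilon>^2 / 8, so the sum is at most \<epsilon>^2 /
      2.\<close>
    also have "\<dots> < \<epsilon>\<^sup>2"
      using small zero_less_power[OF \<epsilon>, of 2] unfolding vw by linarith
    finally show "hnorm (ell2 Y) (\<lambda>i. permutation_rep G Y \<alpha> h w i - w i) < \<epsilon>"
      using \<epsilon> unfolding v_def[symmetric] hnorm_ell2[OF minus] by (intro real_less_lsqrt) auto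
  qed
qed

text \<open>Linearity and invariance of the inner product are direct. Strong continuity at a reduces
  to continuity at the identity for the vector w = \<pi>(a) u, because \<pi>(h a) u = \<pi>(h)
  w.\<close>

lemma unitary_permutation_rep:
  assumes "topological_group G T" "group_action G Y \<alpha>"
    and stab: "\<And>i. i \<in> Y \<Longrightarrow> openin T (stabilizer G \<alpha> i)"
  shows "unitary_representation G T (ell2 Y) (permutation_rep G Y \<alpha>)"
proof -
  interpret topological_group G T by fact
  interpret action: group_action G Y \<alpha> by fact
  interpret H: hilbert_space "ell2 Y" by (rule ell2_hilbert_space)
  interpret M: Metric_space "carrier (ell2 Y)" "hdist (ell2 Y)" by (rule H.Metric_space_hdist)
  interpret rep: group_action G "carrier (ell2 Y)" "permutation_rep G Y \<alpha>"
    by (rule action.group_action_permutation_rep)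
  note closed = action.permutation_rep_closed
  show ?thesis
  proof
    fix u assume u: "u \<in> carrier (ell2 Y)"
    show "continuous_map T (htopology (ell2 Y)) (\<lambda>g. permutation_rep G Y \<alpha> g u)"
      unfolding continuous_map_def htopology_def M.topspace_mtopology topspace_eq
    proof (intro conjI allI impI)
      show "(\<lambda>g. permutation_rep G Y \<alpha> g u) \<in> carrier G \<rightarrow> carrier (ell2 Y)"
        using closed u by blast
      fix O' assume O: "openin M.mtopology O'"
      show "openin T {g \<in> carrier G. permutation_rep G Y \<alpha> g u \<in> O'}"
      proof (subst openin_subopen, intro ballI)
        fix a assume "a \<in> {g \<in> carrier G. permutation_rep G Y \<alpha> g u \<in> O'}"
        then have a: "a \<in> carrier G" and aO: "permutation_rep G Y \<alpha> a u \<in> O'"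
          by auto
        define w where "w = permutation_rep G Y \<alpha> a u"
        have w: "w \<in> carrier (ell2 Y)"
          unfolding w_def by (rule closed[OF a u])
        obtain r where r: "r > 0" "M.mball w r \<subseteq> O'"
          using O aO unfolding M.openin_mtopology w_def by blast
        obtain U where U: "openin T U" "\<one>\<^bsub>G\<^esub> \<in> U"
          "\<And>h. h \<in> U \<Longrightarrow> hnorm (ell2 Y) (\<lambda>i. permutation_rep G Y \<alpha> h w i - w i) < r"
          using permutation_rep_near_one[OF assms w r(1)] by blast
        \<comment> \<open>The right translate \<open>U\<close> a, a neighbourhood of a.\<close>
        define V where "V = {x \<in> carrier G. x \<otimes>\<^bsub>G\<^esub> inv\<^bsub>G\<^esub> a \<in> U}"
        have "openin T V"
          unfolding V_def using a U by (intro openin_preimage continuous_map_right_mult) auto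
        moreover have "a \<in> V"
          using a U by (simp add: V_def)
        moreover have "permutation_rep G Y \<alpha> x u \<in> O'" if "x \<in> V" for x
        proof -
          define h where "h = x \<otimes>\<^bsub>G\<^esub> inv\<^bsub>G\<^esub> a"
          have h: "h \<in> U" "h \<in> carrier G" and x: "x = h \<otimes>\<^bsub>G\<^esub> a"
            using that a by (auto simp: V_def h_def m_assoc)
          have xh: "permutation_rep G Y \<alpha> x u = permutation_rep G Y \<alpha> h w"
            unfolding x w_def by (rule rep.composition_rule[OF u h(2) a])
          have hw: "permutation_rep G Y \<alpha> h w \<in> carrier (ell2 Y)"
            by (rule closed[OF h(2) w])
          have "hdist (ell2 Y) (permutation_rep G Y \<alpha> h w) w < r"
            using U(3)[OF h(1)] hdist_ell2[where Y = Y and W = "carrier (ell2 Y)", unfolded ell2_carrier_update,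
              OF H.M.abelian_group_axioms hw w] by simp
          then have "permutation_rep G Y \<alpha> h w \<in> M.mball w r"
            using hw w by (simp only: M.in_mball M.commute)
          then show ?thesis
            using r xh by auto
        qed
        ultimately show "\<exists>V. openin T V \<and> a \<in> V \<and> V \<subseteq> {g \<in> carrier G. permutation_rep G Y \<alpha> g u \<in> O'}"
          using V_def by blast
      qed
    qed
  next
    fix g u v assume g: "g \<in> carrier G" and u: "u \<in> carrier (ell2 Y)" and v: "v \<in> carrier (ell2 Y)"
    show "permutation_rep G Y \<alpha> g (u \<oplus>\<^bsub>ell2 Y\<^esub> v)
        = permutation_rep G Y \<alpha> g u \<oplus>\<^bsub>ell2 Y\<^esub> permutation_rep G Y \<alpha> g v"
      unfolding action.permutation_rep_apply[OF H.M.a_closed[OF u v]]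
        action.permutation_rep_apply[OF u] action.permutation_rep_apply[OF v] by auto
    show "inner_prod (ell2 Y) (permutation_rep G Y \<alpha> g u) (permutation_rep G Y \<alpha> g v)
        = inner_prod (ell2 Y) u v"
      by (rule action.inner_permutation_rep[OF g u v])
  next
    fix g u c assume g: "g \<in> carrier G" and u: "u \<in> carrier (ell2 Y)"
    have "c \<odot>\<^bsub>ell2 Y\<^esub> u \<in> carrier (ell2 Y)"
      using u by (intro H.smult_closed) auto
    then show "permutation_rep G Y \<alpha> g (c \<odot>\<^bsub>ell2 Y\<^esub> u) = c \<odot>\<^bsub>ell2 Y\<^esub> permutation_rep G Y \<alpha> g u"
      using u by (subst action.permutation_rep_apply) (auto simp: action.permutation_rep_apply)
  qed
qed

lemma indicator_in_ell2: "i \<in> Y \<Longrightarrow> (\<lambda>j. if j = i then 1 else 0) \<in> carrier (ell2 Y)"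
  by (auto intro!: finite_nonzero_values_imp_summable_on finite_subset[of _ "{i}"] split: if_splits)

lemma (in group_action) permutation_rep_fixes_indicator:
  assumes "i \<in> E" "g \<in> stabilizer G \<phi> i"
  shows "permutation_rep G E \<phi> g (\<lambda>j. if j = i then 1 else 0) = (\<lambda>j. if j = i then 1 else 0)"
proof -
  have g: "g \<in> carrier G" "\<phi> g i = i"
    using assms(2) by (auto simp: stabilizer_def)
  have "\<phi> (inv\<^bsub>G\<^esub> g) j = i \<longleftrightarrow> j = i" if "j \<in> E" for j
    using bij_betw_inv_action[OF g(1)] orbit_sym_aux[OF g(1) assms(1) g(2)] that assms(1)
    by (auto simp: bij_betw_def inj_on_def)
  then show ?thesis
    using assms(1) by (auto simp: permutation_rep_apply[OF indicator_in_ell2])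
qed

text \<open>The point mass at a point fixed by \<open>K\<close> is exactly invariant under
  \<open>K\<close>, so it serves for every \<epsilon>.\<close>

lemma permutation_rep_almost_has_invariant_vectors:
  assumes "group_action G Y \<alpha>"
    and fixpt: "\<And>K. compactin T K \<Longrightarrow> \<exists>i\<in>Y. K \<subseteq> stabilizer G \<alpha> i"
  shows "almost_has_invariant_vectors T (ell2 Y) (permutation_rep G Y \<alpha>)"
  unfolding almost_has_invariant_vectors_def
proof (intro allI impI)
  fix K and \<epsilon> :: real assume K: "compactin T K \<and> \<epsilon> > 0"
  interpret action: group_action G Y \<alpha> by fact
  interpret H: inner_product_space "ell2 Y" by (rule ell2_inner_product_space)
  obtain i where i: "i \<in> Y" "K \<subseteq> stabilizer G \<alpha> i"
    using fixpt K by blast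
  define \<xi> where "\<xi> = (\<lambda>j. if j = i then 1 else (0 :: complex))"
  have \<xi>: "\<xi> \<in> carrier (ell2 Y)"
    unfolding \<xi>_def by (rule indicator_in_ell2[OF i(1)])
  have "hnorm (ell2 Y) (permutation_rep G Y \<alpha> g \<xi> \<ominus>\<^bsub>ell2 Y\<^esub> \<xi>) \<le> \<epsilon> * hnorm (ell2 Y) \<xi>" if "g \<in> K" for g
  proof -
    have "permutation_rep G Y \<alpha> g \<xi> \<ominus>\<^bsub>ell2 Y\<^esub> \<xi> = \<zero>\<^bsub>ell2 Y\<^esub>"
      using action.permutation_rep_fixes_indicator[of i g] i that H.M.r_neg[OF \<xi>]
      by (auto simp: \<xi>_def H.M.minus_eq)
    then have "hnorm (ell2 Y) (permutation_rep G Y \<alpha> g \<xi> \<ominus>\<^bsub>ell2 Y\<^esub> \<xi>) = 0"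
      using H.hnorm_eq_0[OF H.M.zero_closed] by (simp del: ell2_simps)
    then show ?thesis
      using K H.hnorm_nonneg[OF \<xi>] by simp
  qed
  moreover have "\<xi> i \<noteq> 0"
    by (simp add: \<xi>_def)
  ultimately show "\<exists>\<xi>\<in>carrier (ell2 Y). \<xi> \<noteq> \<zero>\<^bsub>ell2 Y\<^esub> \<and>
      (\<forall>g\<in>K. hnorm (ell2 Y) (permutation_rep G Y \<alpha> g \<xi> \<ominus>\<^bsub>ell2 Y\<^esub> \<xi>) \<le> \<epsilon> * hnorm (ell2 Y) \<xi>)"
    using \<xi> by (intro bexI[of _ \<xi>]) auto
qed

text \<open>On an infinite set of such indices the positive constant c^2 would be summable by
  comparison.\<close>

lemma ell2_finite_large:
  assumes "u \<in> carrier (ell2 Y)" "c > 0"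
  shows "finite {i \<in> Y. c \<le> cmod (u i)}"
proof -
  let ?A = "{i \<in> Y. c \<le> cmod (u i)}"
  have "(\<lambda>i. (cmod (u i))\<^sup>2) summable_on ?A"
    using assms(1) by (auto intro: summable_on_subset)
  then have "(\<lambda>i. c\<^sup>2) summable_on ?A"
    by (rule summable_on_comparison_test) (use assms(2) in \<open>auto intro: power_mono\<close>)
  then show ?thesis
    using infsum_diverge_constant[of ?A "c\<^sup>2"] assms(2) by auto
qed

text \<open>
  If \<open>\<xi>\<close> is a nonzero vector of \<open>W\<close> and \<open>\<xi> x \<noteq> 0\<close>, then an element moving \<open>\<xi>\<close> by less than
  \<open>\<bar>\<xi> x\<bar> / 2\<close> moves \<open>x\<close> into the finite set where \<open>\<bar>\<xi>\<bar>\<close> is at least \<open>\<bar>\<xi> x\<bar> / 2\<close>.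
\<close>

lemma subrep_through_morphism_finite_orbit:
  assumes action: "group_action G Y \<alpha>" and f: "f \<in> hom G Q"
    and W: "W \<subseteq> carrier (ell2 Y)" "W \<noteq> {\<zero>\<^bsub>ell2 Y\<^esub>}"
    and rep: "unitary_representation Q S (ell2 Y\<lparr>carrier := W\<rparr>) \<rho>"
    and fact: "\<And>g. g \<in> carrier G \<Longrightarrow> restrict (permutation_rep G Y \<alpha> g) W = \<rho> (f g)"
  obtains x F V where "x \<in> Y" "finite F" "F \<subseteq> Y" "openin S V" "\<one>\<^bsub>Q\<^esub> \<in> V"
    "{g \<in> carrier G. f g \<in> V} \<subseteq> {g \<in> carrier G. \<alpha> g x \<in> F}"
proof -
  let ?H = "ell2 Y\<lparr>carrier := W\<rparr>"
  interpret action: group_action G Y \<alpha> by fact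
  interpret rep: unitary_representation Q S ?H \<rho> by fact
  interpret M: Metric_space W "hdist ?H"
    using rep.Metric_space_hdist by simp
  have ab: "abelian_group ?H" ..
  have "\<zero>\<^bsub>ell2 Y\<^esub> \<in> W"
    using abelian_group.axioms(1)[OF ab] abelian_monoid.zero_closed by fastforce
  with W(2) obtain \<xi> where \<xi>: "\<xi> \<in> W" "\<xi> \<noteq> (\<lambda>i. 0)"
    by auto
  then obtain x where x: "\<xi> x \<noteq> 0"
    by auto
  have \<xi>Y: "\<xi> \<in> carrier (ell2 Y)"
    using \<xi> W by blast
  then have xY: "x \<in> Y"
    using x by auto
  define c where "c = cmod (\<xi> x) / 2"
  have c: "c > 0"
    using x by (simp add: c_def)
  define F where "F = {i \<in> Y. c \<le> cmod (\<xi> i)}"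
  \<comment> \<open>This set is open in Q because \<rho> is strongly continuous on Q; here the
    factorisation through f turns a condition on g into one on f(g).\<close>
  define V where "V = {q \<in> topspace S. \<rho> q \<xi> \<in> M.mball \<xi> c}"
  show thesis
  proof
    show "finite F"
      unfolding F_def by (rule ell2_finite_large[OF \<xi>Y c])
    show "openin S V"
      unfolding V_def
    proof (rule openin_continuous_map_preimage)
      show "continuous_map S M.mtopology (\<lambda>q. \<rho> q \<xi>)"
        using rep.strongly_continuous[of \<xi>] \<xi> by (simp add: htopology_def)
    qed auto
    have "\<rho> \<one>\<^bsub>Q\<^esub> \<xi> = \<xi>"
      using fun_cong[OF rep.id_eq_one, of \<xi>] \<xi>(1) by simp
    then show "\<one>\<^bsub>Q\<^esub> \<in> V"
      using \<xi>(1) c by (simp add: V_def rep.topspace_eq)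
    have "\<alpha> g x \<in> F" if g: "g \<in> carrier G" and "f g \<in> V" for g
    proof -
      define v where "v = permutation_rep G Y \<alpha> g \<xi>"
      have "\<rho> (f g) \<xi> = v"
        using fact[OF g] \<xi>(1) unfolding v_def by (metis restrict_apply')
      with \<open>f g \<in> V\<close> have vW: "v \<in> W" and "hdist ?H \<xi> v < c"
        by (simp_all add: V_def)
      then have "hnorm (ell2 Y) (\<lambda>i. \<xi> i - v i) < c"
        using hdist_ell2[OF ab \<xi>(1) vW] by simp
      moreover have "(\<lambda>i. \<xi> i - v i) \<in> carrier (ell2 Y)"
        using \<xi>Y vW W(1) square_summable_add[of \<xi> Y "\<lambda>i. - v i"] by auto
      ultimately have "cmod (\<xi> (\<alpha> g x) - v (\<alpha> g x)) < c"
        by (rule le_less_trans[OF cmod_le_hnorm_ell2, rotated])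
      moreover have gx: "\<alpha> g x \<in> Y"
        using action.element_image[OF g xY refl] .
      \<comment> \<open>The translate v takes at g x the value of \<xi> at g^-1 (g x) = x.\<close>
      then have "v (\<alpha> g x) = \<xi> x"
        using action.orbit_sym_aux[OF g xY refl] by (simp only: v_def action.permutation_rep_apply[OF \<xi>Y] if_True)
      \<comment> \<open>As c is half of the modulus of \<xi> x, the modulus of \<xi> at g x stays
        above c, which puts g x into \<open>F\<close>.\<close>
      ultimately have "cmod (\<xi> x) - cmod (\<xi> (\<alpha> g x)) < c"
        using norm_triangle_ineq2[of "\<xi> x" "\<xi> (\<alpha> g x)"] by (simp add: norm_minus_commute)
      then show ?thesis
        using gx by (simp add: F_def c_def)
    qed
    then show "{g \<in> carrier G. f g \<in> V} \<subseteq> {g \<in> carrier G. \<alpha> g x \<in> F}"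
      by blast
  qed (use xY F_def in auto)
qed

section \<open>The G-set of cosets: open stabilizers, finite sets of translates and fixed
  points\<close>

section \<open>Cosets of open compactly generated subgroups\<close>

text \<open>This is the disjoint union of the coset spaces G/H over all open compactly generated H:
  a left coset A determines its subgroup as A^-1 A, so plain subsets of G can serve as
  indices.\<close>

definition open_cosets :: "('g, 'm) monoid_scheme \<Rightarrow> 'g topology \<Rightarrow> 'g set set"
  where "open_cosets G T =
    {a <#\<^bsub>G\<^esub> generate G C | a C. a \<in> carrier G \<and> compactin T C \<and> openin T (generate G C)}"

text \<open>The second components only serve to fit the index set into the universe of a resolution.\<close>

definition coset_action ::
    "('g, 'm) monoid_scheme \<Rightarrow> 'g topology \<Rightarrow> 'g \<Rightarrow> 'g set \<times> nat \<Rightarrow> 'g set \<times> nat"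
  where "coset_action G T g = (\<lambda>(A, n)\<in>open_cosets G T \<times> {0}. (g <#\<^bsub>G\<^esub> A, n))"

context topological_group
begin

lemma open_cosetsE:
  assumes "A \<in> open_cosets G T"
  obtains a C where "A = a <# generate G C" "a \<in> carrier G" "compactin T C"
    "openin T (generate G C)" "subgroup (generate G C) G"
  using assms generate_is_subgroup compactin_subset_carrier unfolding open_cosets_def by blast

lemma group_action_coset_action: "group_action G (open_cosets G T \<times> {0}) (coset_action G T)"
proof (rule group_actionI)
  have sub: "A \<subseteq> carrier G" if "A \<in> open_cosets G T" for A
    using that by (elim open_cosetsE) (simp add: l_coset_subset_G subgroup.subset)
  have closed: "g <# A \<in> open_cosets G T" if "g \<in> carrier G" "A \<in> open_cosets G T" for g A
    using that(2)
  proof (cases rule: open_cosetsE)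
    case (1 a C)
    then have "g <# A = (g \<otimes> a) <# generate G C"
      using that(1) by (simp add: lcos_m_assoc subgroup.subset)
    then show ?thesis
      using 1 that(1) unfolding open_cosets_def by blast
  qed
  fix g i assume g: "g \<in> carrier G" and i: "i \<in> open_cosets G T \<times> {0::nat}"
  show "coset_action G T g i \<in> open_cosets G T \<times> {0}"
    using closed[OF g] i by (auto simp: coset_action_def)
  fix h assume h: "h \<in> carrier G"
  show "coset_action G T (g \<otimes> h) i = coset_action G T g (coset_action G T h i)"
    using closed[OF h] g h i sub by (auto simp: coset_action_def lcos_m_assoc)
next
  fix i assume "i \<in> open_cosets G T \<times> {0::nat}"
  then show "coset_action G T \<one> i = i"
    by (auto simp: coset_action_def lcos_mult_one l_coset_subset_G subgroup.subset elim!: open_cosetsE)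
qed (simp add: coset_action_def)

text \<open>The stabilizer of the coset a H contains the conjugate a H a^-1, which is the preimage
  of the open subgroup H under a continuous map.\<close>

lemma openin_stabilizer_coset_action:
  assumes "i \<in> open_cosets G T \<times> {0}"
  shows "openin T (stabilizer G (coset_action G T) i)"
proof -
  interpret action: group_action G "open_cosets G T \<times> {0}" "coset_action G T"
    by (rule group_action_coset_action)
  obtain A where A: "A \<in> open_cosets G T" "i = (A, 0)"
    using assms by auto
  from A(1) obtain a C where a: "A = a <# generate G C" "a \<in> carrier G" "openin T (generate G C)"
    and H: "subgroup (generate G C) G"
    by (rule open_cosetsE)
  let ?H = "generate G C"
  show ?thesis
  proof (rule openin_subgroupI)
    show "subgroup (stabilizer G (coset_action G T) i) G"
      by (rule action.stabilizer_subgroup[OF assms])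
    show "openin T {g \<in> carrier G. inv a \<otimes> (g \<otimes> a) \<in> ?H}"
      using a by (intro openin_preimage continuous_map_mult) (auto simp: topspace_eq)
    show "\<one> \<in> {g \<in> carrier G. inv a \<otimes> (g \<otimes> a) \<in> ?H}"
      using a subgroup.one_closed[OF H] by simp
    show "{g \<in> carrier G. inv a \<otimes> (g \<otimes> a) \<in> ?H} \<subseteq> stabilizer G (coset_action G T) i"
    proof clarify
      fix g assume g: "g \<in> carrier G" and h: "inv a \<otimes> (g \<otimes> a) \<in> ?H"
      have "g <# A = (g \<otimes> a) <# ?H"
        using a g H by (simp add: lcos_m_assoc subgroup.subset)
      also have "g \<otimes> a = a \<otimes> (inv a \<otimes> (g \<otimes> a))"
        using a g by (simp add: m_assoc[symmetric])
      also have "\<dots> <# ?H = a <# ((inv a \<otimes> (g \<otimes> a)) <# ?H)"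
        using a g H by (simp add: lcos_m_assoc subgroup.subset)
      also have "(inv a \<otimes> (g \<otimes> a)) <# ?H = ?H"
        using a g h H by (intro coset_join3) auto
      finally show "g \<in> stabilizer G (coset_action G T) i"
        using g A a by (simp add: stabilizer_def coset_action_def)
    qed
  qed
qed

text \<open>If g sends a H to a coset with chosen representative b, then b = g a h with h in H, so g
  = b (a h)^-1. Thus a and the finitely many representatives, added to the compact set generating H,
  generate all such g.\<close>

lemma coset_action_finite_orbit_compactly_generated:
  assumes x: "x \<in> open_cosets G T \<times> {0}" and F: "finite F" "F \<subseteq> open_cosets G T \<times> {0}"
  obtains C where "compactin T C" "{g \<in> carrier G. coset_action G T g x \<in> F} \<subseteq> generate G C"
proof -
  obtain A where A: "A \<in> open_cosets G T" "x = (A, 0)"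
    using x by auto
  from A(1) obtain a C where a: "A = a <# generate G C" "a \<in> carrier G" "compactin T C"
    and H: "subgroup (generate G C) G"
    by (rule open_cosetsE)
  have mem: "(SOME b. b \<in> fst i) \<in> fst i" "fst i \<subseteq> carrier G" if "i \<in> F" for i
  proof -
    have "fst i \<in> open_cosets G T"
      using that F by auto
    then obtain b D where b: "fst i = b <# generate G D" "b \<in> carrier G" "subgroup (generate G D) G"
      by (rule open_cosetsE)
    then have "b \<otimes> \<one> \<in> fst i"
      using subgroup.one_closed unfolding l_coset_def by fast
    then show "(SOME b. b \<in> fst i) \<in> fst i"
      by (rule someI)
    show "fst i \<subseteq> carrier G"
      using b by (simp add: l_coset_subset_G subgroup.subset)
  qed
  define C' where "C' = C \<union> insert a ((\<lambda>i. SOME b. b \<in> fst i) ` F)"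
  have "insert a ((\<lambda>i. SOME b. b \<in> fst i) ` F) \<subseteq> topspace T"
    using a(2) mem unfolding topspace_eq by blast
  then have "compactin T C'"
    unfolding C'_def using F(1) by (intro compactin_Un a(3) finite_imp_compactin) auto
  have "g \<in> generate G C'" if g: "g \<in> carrier G" "coset_action G T g x \<in> F" for g
  proof -
    interpret D: subgroup "generate G C'" G
      using \<open>compactin T C'\<close> by (intro generate_is_subgroup compactin_subset_carrier)
    define b where "b = (SOME b. b \<in> fst (coset_action G T g x))"
    have "b \<in> generate G C'"
      using g(2) by (auto simp: b_def C'_def intro: generate.incl)
    have "a \<in> generate G C'"
      by (auto simp: C'_def intro: generate.incl)
    have "b \<in> g <# (a <# generate G C)"
      using mem(1)[OF g(2)] A a by (simp add: b_def coset_action_def)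
    then obtain h where h: "h \<in> generate G C" "b = g \<otimes> (a \<otimes> h)"
      by (auto simp: l_coset_def)
    have "h \<in> generate G C'"
      using h(1) mono_generate[of C C'] by (auto simp: C'_def)
    have "h \<in> carrier G"
      using h(1) subgroup.subset[OF H] by blast
    then have "b \<otimes> inv (a \<otimes> h) = g"
      unfolding h(2) using g(1) a by (simp add: m_assoc)
    moreover have "b \<otimes> inv (a \<otimes> h) \<in> generate G C'"
      by (intro D.m_closed D.m_inv_closed) fact+
    ultimately show ?thesis
      by simp
  qed
  then show thesis
    using that[OF \<open>compactin T C'\<close>] by blast
qed

end

text \<open>The fixed point is the trivial coset of an open compactly generated subgroup containing
  \<open>K\<close>.\<close>

lemma (in locally_compact_group) coset_action_compact_fixes:
  assumes "compactin T K"
  shows "\<exists>i\<in>open_cosets G T \<times> {0}. K \<subseteq> stabilizer G (coset_action G T) i"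
proof -
  obtain C where C: "compactin T C" "K \<subseteq> generate G C" "openin T (generate G C)"
    by (rule compact_subset_open_compactly_generated[OF assms])
  have H: "subgroup (generate G C) G"
    by (intro generate_is_subgroup compactin_subset_carrier C)
  then have "generate G C = \<one> <# generate G C"
    by (simp add: lcos_mult_one subgroup.subset)
  then have mem: "generate G C \<in> open_cosets G T"
    using C unfolding open_cosets_def by blast
  have K: "g \<in> carrier G" if "g \<in> K" for g
    using that assms compactin_subset_carrier by blast
  then have "g <# generate G C = generate G C" if "g \<in> K" for g
    using that C(2) H by (intro coset_join3) auto
  with K show ?thesis
    using mem by (intro bexI[of _ "(generate G C, 0)"]) (auto simp: stabilizer_def coset_action_def)
qed

section \<open>Transfer of compact generation in both directions, and the theorem\<close>

section \<open>Morphisms with dense image\<close>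

text \<open>By density every q is f(g) u with u in the compact neighbourhood \<open>L\<close>, and
  f(g) lies in the subgroup generated by the image of \<open>K\<close>.\<close>

lemma compactly_generated_dense_image:
  assumes "topological_group G T" "locally_compact_group Q S"
    and f: "topological_group_morphism G T Q S f"
    and dense: "S closure_of (f ` carrier G) = carrier Q"
    and "compactly_generated G T"
  shows "compactly_generated Q S"
proof -
  interpret G: topological_group G T by fact
  interpret Q: locally_compact_group Q S by fact
  interpret hom: group_hom G Q f
    using f by unfold_locales (simp add: topological_group_morphism_def)
  obtain K where K: "compactin T K" "generate G K = carrier G"
    using assms(5) by (auto simp: compactly_generated_def)
  obtain U L where UL: "openin S U" "compactin S L" "\<one>\<^bsub>Q\<^esub> \<in> U" "U \<subseteq> L"
    by (rule Q.compact_neighbourhood_one)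
  have fK: "compactin S (f ` K)"
    using K f by (auto simp: topological_group_morphism_def intro: image_compactin)
  have C: "compactin S (f ` K \<union> L)"
    using fK UL by (simp add: compactin_Un)
  interpret D: subgroup "generate Q (f ` K \<union> L)" Q
    by (intro Q.generate_is_subgroup Q.compactin_subset_carrier C)
  have "q \<in> generate Q (f ` K \<union> L)" if q: "q \<in> carrier Q" for q
  proof -
    have "q \<in> S closure_of (f ` carrier G)"
      unfolding dense by (rule q)
    from Q.closure_of_div[OF this UL(1,3)]
    obtain g where g: "g \<in> carrier G" "inv\<^bsub>Q\<^esub> (f g) \<otimes>\<^bsub>Q\<^esub> q \<in> U"
      by auto
    have "f g \<in> generate Q (f ` K)"
      using hom.generate_img[of K] K G.compactin_subset_carrier g(1) by auto
    then have fg: "f g \<in> generate Q (f ` K \<union> L)"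
      using Q.mono_generate[of "f ` K" "f ` K \<union> L"] by blast
    have "inv\<^bsub>Q\<^esub> (f g) \<otimes>\<^bsub>Q\<^esub> q \<in> generate Q (f ` K \<union> L)"
      using g UL by (auto intro: generate.incl)
    with fg have "f g \<otimes>\<^bsub>Q\<^esub> (inv\<^bsub>Q\<^esub> (f g) \<otimes>\<^bsub>Q\<^esub> q) \<in> generate Q (f ` K \<union> L)"
      by (rule D.m_closed)
    then show ?thesis
      using g q by (simp add: Q.m_assoc[symmetric])
  qed
  then have "generate Q (f ` K \<union> L) = carrier Q"
    using D.subset by blast
  with C show ?thesis
    by (auto simp: compactly_generated_def)
qed

text \<open>Compactness of \<open>K\<close> supplies the finite set \<open>B\<close> to be added to
  \<open>C\<close>. The resulting subgroup \<open>D\<close> contains the preimage of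
  \<open>V\<close> and has dense image, and these two properties force \<open>D\<close> to be all of
  G.\<close>

lemma compactly_generated_dense_preimage:
  assumes "topological_group G T" "topological_group Q S"
    and f: "topological_group_morphism G T Q S f"
    and dense: "S closure_of (f ` carrier G) = carrier Q"
    and V: "openin S V" "\<one>\<^bsub>Q\<^esub> \<in> V"
    and C: "compactin T C" "{g \<in> carrier G. f g \<in> V} \<subseteq> generate G C"
    and "compactly_generated Q S"
  shows "compactly_generated G T"
proof -
  interpret G: topological_group G T by fact
  interpret Q: topological_group Q S by fact
  interpret hom: group_hom G Q f
    using f by unfold_locales (simp add: topological_group_morphism_def)
  obtain K where K: "compactin S K" "generate Q K = carrier Q"
    using assms(9) by (auto simp: compactly_generated_def)
  \<comment> \<open>The translate f(g) \<open>V\<close>. Since the image of f is dense, these open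
    sets cover Q.\<close>
  define N where "N g = {q \<in> carrier Q. inv\<^bsub>Q\<^esub> (f g) \<otimes>\<^bsub>Q\<^esub> q \<in> V}" for g
  have N: "openin S (N g)" if "g \<in> carrier G" for g
    unfolding N_def using that V by (intro Q.openin_preimage Q.continuous_map_left_mult) auto
  have near: "\<exists>g\<in>A. k \<in> N g" if k: "k \<in> carrier Q" "k \<in> S closure_of (f ` A)" for k A
    using Q.closure_of_div[OF k(2) V] k(1) by (simp add: N_def)
  have "K \<subseteq> \<Union> (N ` carrier G)"
    using near[of _ "carrier G"] Q.compactin_subset_carrier[OF K(1)] dense by blast
  then have "\<exists>\<F>. finite \<F> \<and> \<F> \<subseteq> N ` carrier G \<and> K \<subseteq> \<Union>\<F>"
    using N by (intro compactinD[OF K(1)]) auto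
  then obtain B where B: "finite B" "B \<subseteq> carrier G" "K \<subseteq> \<Union> (N ` B)"
    by (metis finite_subset_image)
  have CB: "compactin T (C \<union> B)"
    using B by (intro compactin_Un C(1) finite_imp_compactin) (auto simp: G.topspace_eq)
  define D where "D = generate G (C \<union> B)"
  interpret D: subgroup D G
    unfolding D_def by (intro G.generate_is_subgroup G.compactin_subset_carrier CB)
  have VD: "g \<in> D" if "g \<in> carrier G" "f g \<in> V" for g
    using that C(2) G.mono_generate[of C "C \<union> B"] by (auto simp: D_def)
  define M where "M = S closure_of (f ` D)"
  have "subgroup (f ` D) Q"
    by (rule hom.subgroup_img_is_subgroup) (rule D.subgroup_axioms)
  then interpret M: subgroup M Q
    unfolding M_def by (rule Q.subgroup_closure_of)
  \<comment> \<open>As \<open>V\<close> is open, each of its points is a limit of points f(g) lying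
    in \<open>V\<close>, and every such g belongs to \<open>D\<close>.\<close>
  have VM: "V \<subseteq> M"
  proof -
    have "V \<subseteq> V \<inter> S closure_of (f ` carrier G)"
      using V(1) dense Q.openin_subset_carrier by simp
    also have "\<dots> \<subseteq> S closure_of (V \<inter> f ` carrier G)"
      by (rule openin_Int_closure_of_subset[OF V(1)])
    also have "\<dots> \<subseteq> M"
      unfolding M_def using VD by (intro closure_of_mono) auto
    finally show ?thesis .
  qed
  have "f ` D \<subseteq> M"
    unfolding M_def by (intro closure_of_subset) (auto simp: Q.topspace_eq)
  have "K \<subseteq> M"
  proof
    fix k assume "k \<in> K"
    then obtain g where g: "g \<in> B" "k \<in> carrier Q" "inv\<^bsub>Q\<^esub> (f g) \<otimes>\<^bsub>Q\<^esub> k \<in> V"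
      using B(3) by (auto simp: N_def)
    have "g \<in> D"
      using g(1) by (auto simp: D_def intro: generate.incl)
    then have "f g \<in> M"
      using \<open>f ` D \<subseteq> M\<close> by blast
    moreover have "inv\<^bsub>Q\<^esub> (f g) \<otimes>\<^bsub>Q\<^esub> k \<in> M"
      using VM g(3) by blast
    ultimately have "f g \<otimes>\<^bsub>Q\<^esub> (inv\<^bsub>Q\<^esub> (f g) \<otimes>\<^bsub>Q\<^esub> k) \<in> M"
      by (rule M.m_closed)
    moreover have "f g \<in> carrier Q"
      using g(1) B(2) by auto
    ultimately show "k \<in> M"
      using g(2) by (simp add: Q.m_assoc[symmetric])
  qed
  then have M: "carrier Q \<subseteq> M"
    using Q.generate_subgroup_incl[OF _ M.subgroup_axioms] K(2) by blast
  have "g \<in> D" if g: "g \<in> carrier G" for g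
  proof -
    \<comment> \<open>The image of \<open>D\<close> is dense, so f(g) lies in f(d) \<open>V\<close>
      for some d in \<open>D\<close>; then d^-1 g is mapped into \<open>V\<close> and hence lies in
      \<open>D\<close>.\<close>
    obtain d where d: "d \<in> D" "f g \<in> N d"
      using near[of "f g" D] g M D.subset hom.hom_closed unfolding M_def by blast
    then have "f (inv\<^bsub>G\<^esub> d \<otimes>\<^bsub>G\<^esub> g) \<in> V"
      using g by (simp add: N_def)
    then have "inv\<^bsub>G\<^esub> d \<otimes>\<^bsub>G\<^esub> g \<in> D"
      using d g by (intro VD) auto
    with d(1) have "d \<otimes>\<^bsub>G\<^esub> (inv\<^bsub>G\<^esub> d \<otimes>\<^bsub>G\<^esub> g) \<in> D"
      by (rule D.m_closed)
    then show ?thesis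
      using d g by (simp add: G.m_assoc[symmetric])
  qed
  then have "D = carrier G"
    using D.subset by blast
  with CB show ?thesis
    by (auto simp: compactly_generated_def D_def)
qed

theorem theorem1p9:
  fixes G :: "('g, 'm) monoid_scheme" and T :: "'g topology"
    and Q :: "('q, 'n) monoid_scheme" and S :: "'q topology"
    and f :: "'g \<Rightarrow> 'q"
  assumes "locally_compact_group G T" and "locally_compact_group Q S"
    and "resolution G T Q S f"
  shows "compactly_generated G T \<longleftrightarrow> compactly_generated Q S"
proof -
  interpret G: locally_compact_group G T by fact
  interpret Q: locally_compact_group Q S by fact
  have f: "topological_group_morphism G T Q S f"
    and dense: "S closure_of (f ` carrier G) = carrier Q"
    and sub: "\<And>(H :: 'g universe hilbert) \<pi>.
      unitary_representation G T H \<pi> \<Longrightarrow> almost_has_invariant_vectors T H \<pi> \<Longrightarrow>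
      \<exists>W \<rho>. invariant_subspace G H \<pi> W \<and> W \<noteq> {\<zero>\<^bsub>H\<^esub>} \<and>
        unitary_representation Q S (H\<lparr>carrier := W\<rparr>) \<rho> \<and>
        (\<forall>g \<in> carrier G. restrict (\<pi> g) W = \<rho> (f g))"
    using assms(3) unfolding resolution_def by blast+
  \<comment> \<open>The factor {0} gives \<open>ell2 Y\<close> the type
    \<open>'g universe hilbert\<close>, to which the resolution property applies.\<close>
  define Y where "Y = open_cosets G T \<times> {0::nat}"
  define \<alpha> where "\<alpha> = coset_action G T"
  have action: "group_action G Y \<alpha>"
    unfolding Y_def \<alpha>_def by (rule G.group_action_coset_action)
  have "unitary_representation G T (ell2 Y) (permutation_rep G Y \<alpha>)"
    using G.topological_group_axioms action G.openin_stabilizer_coset_action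
    by (intro unitary_permutation_rep) (auto simp: Y_def \<alpha>_def)
  moreover have "almost_has_invariant_vectors T (ell2 Y) (permutation_rep G Y \<alpha>)"
    using action G.coset_action_compact_fixes
    by (intro permutation_rep_almost_has_invariant_vectors) (auto simp: Y_def \<alpha>_def)
  ultimately obtain W \<rho> where W: "invariant_subspace G (ell2 Y) (permutation_rep G Y \<alpha>) W" "W \<noteq> {\<zero>\<^bsub>ell2 Y\<^esub>}"
    and rep: "unitary_representation Q S (ell2 Y\<lparr>carrier := W\<rparr>) \<rho>"
    and fact: "\<And>g. g \<in> carrier G \<Longrightarrow> restrict (permutation_rep G Y \<alpha> g) W = \<rho> (f g)"
    using sub[of "ell2 Y" "permutation_rep G Y \<alpha>"] by blast
  have Y: "W \<subseteq> carrier (ell2 Y)"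
    using W(1) subgroup.subset[of W "add_monoid (ell2 Y)"]
    by (simp only: invariant_subspace_def submodule_def partial_object.select_convs)
  have hom: "f \<in> hom G Q"
    using f by (simp add: topological_group_morphism_def)
  \<comment> \<open>The neighbourhood \<open>V\<close> and the compact set \<open>C\<close> obtained
    next come from the resolution alone, before compact generation of either group is
    assumed.\<close>
  obtain x F V where x: "x \<in> Y" and F: "finite F" "F \<subseteq> Y"
    and V: "openin S V" "\<one>\<^bsub>Q\<^esub> \<in> V" and orbit: "{g \<in> carrier G. f g \<in> V} \<subseteq> {g \<in> carrier G. \<alpha> g x \<in> F}"
    by (rule subrep_through_morphism_finite_orbit[OF action hom Y W(2) rep fact])
  obtain C where C: "compactin T C" "{g \<in> carrier G. \<alpha> g x \<in> F} \<subseteq> generate G C"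
    unfolding \<alpha>_def
    by (rule G.coset_action_finite_orbit_compactly_generated[OF x[unfolded Y_def] F[unfolded Y_def]])
  show ?thesis
  proof
    show "compactly_generated Q S" if "compactly_generated G T"
      by (rule compactly_generated_dense_image[OF G.topological_group_axioms assms(2) f dense that])
    show "compactly_generated G T" if "compactly_generated Q S"
      by (rule compactly_generated_dense_preimage[OF G.topological_group_axioms
            Q.topological_group_axioms f dense V C(1) subset_trans[OF orbit C(2)] that])
  qed
qed

end
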